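(* Let $X \in \mathbb{R}^{n\times n}_+$ and let $\beta_1,\beta_2>0$. Then $$S^{\beta_2}_X = \mathcal{P}_{sk}\Big( (S^{\beta_1}_X)^{\circ(\beta_2/\beta_1)}\Big).$$
   Context: $\mathbb{R}^{n\times n}_+$ (resp. $\mathbb{R}^n_+$) denotes the real $n\times n$ matrices (resp. $n$-vectors) with all entries strictly positive. $\Sigma_{n\times n}$ is the set of $n\times n$ doubly stochastic matrices: entrywise nonnegative matrices with all row sums and all column sums equal to $1$. For a vector $\mathbf{x}$, $D_{(\mathbf{x})}$ is the diagonal matrix with diagonal $\mathbf{x}$. Sinkhorn operator: for $Y\in\mathbb{R}^{n\times n}_+$, $\mathcal{P}_{sk}(Y)=D_{(\mathbf r)}YD_{(\mathbf c)}$, where $\mathbf r,\mathbf c\in\mathbb{R}^n_+$ are balancing vectors, i.e. such that $D_{(\mathbf r)}YD_{(\mathbf c)}$ is doubly stochastic (by Sinkhorn's theorem such vectors exist and the resulting doubly stochastic matrix is unique). Hadamard power: $Y^{\circ p}$ is the matrix with entries $Y_{ij}^p$. Softassign: for a real $n\times n$ matrix $X$ and $\beta>0$, $S^\beta_X$ is the unique maximizer over $S\in\Sigma_{n\times n}$ of $\langle S,X\rangle+\frac1\beta\mathcal{H}(S)$, where $\langle S,X\rangle=\sum_{ij}S_{ij}X_{ij}$ and $\mathcal{H}(S)=-\sum_{ij}S_{ij}\ln S_{ij}$ (with $0\ln 0=0$). Equivalently (a known fact), $S^\beta_X=\mathcal{P}_{sk}(\exp(\beta X))$, with $\exp$ taken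 entrywise. *)

theory Defs
  imports "HOL-Analysis.Analysis"
begin

definition positive_vec :: "real^'n \<Rightarrow> bool" where
  "positive_vec x \<longleftrightarrow> (\<forall>i. x $ i > 0)"

definition positive_mat :: "real^'n^'n \<Rightarrow> bool" where
  "positive_mat X \<longleftrightarrow> (\<forall>i j. X $ i $ j > 0)"

definition doubly_stochastic :: "(real^'n^'n) set" where
  "doubly_stochastic = {S. (\<forall>i j. S $ i $ j \<ge> 0) \<and>
     (\<forall>i. (\<Sum>j\<in>UNIV. S $ i $ j) = 1) \<and> (\<forall>j. (\<Sum>i\<in>UNIV. S $ i $ j) = 1)}"

definition diag_mat :: "real^'n \<Rightarrow> real^'n^'n" where
  "diag_mat x = (\<chi> i j. if i = j then x $ i else 0)"

(* Meaningful for positive Y: there, by Sinkhorn's theorem, exactly one such P exists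
   (the balancing vectors r and c themselves are unique only up to reciprocal scaling). *)
definition sinkhorn :: "real^'n^'n \<Rightarrow> real^'n^'n" where
  "sinkhorn Y = (THE P. P \<in> doubly_stochastic \<and>
     (\<exists>r c. positive_vec r \<and> positive_vec c \<and> P = diag_mat r ** Y ** diag_mat c))"

definition hadamard_power :: "real^'n^'n \<Rightarrow> real \<Rightarrow> real^'n^'n" where
  "hadamard_power Y p = (\<chi> i j. (Y $ i $ j) powr p)"

(* The convention 0 * ln 0 = 0 holds automatically, since 0 * x = 0. *)
definition entropy_mat :: "real^'n^'n \<Rightarrow> real" where
  "entropy_mat S = - (\<Sum>i\<in>UNIV. \<Sum>j\<in>UNIV. S $ i $ j * ln (S $ i $ j))"

(* On real^'n^'n the library inner product is the sum of S $ i $ j * X $ i $ j over all i, j. *)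
definition softassign_objective :: "real \<Rightarrow> real^'n^'n \<Rightarrow> real^'n^'n \<Rightarrow> real" where
  "softassign_objective \<beta> X S = S \<bullet> X + (1 / \<beta>) * entropy_mat S"

definition softassign :: "real \<Rightarrow> real^'n^'n \<Rightarrow> real^'n^'n" where
  "softassign \<beta> X =
     (THE S. is_arg_max (softassign_objective \<beta> X) (\<lambda>S. S \<in> doubly_stochastic) S)"

end

theory Submission
  imports Defs "HOL-Real_Asymp.Real_Asymp"
begin

text \<open>
  If a doubly stochastic \<open>P\<close> is a diagonal scaling of \<open>exp (\<beta> X)\<close>, then \<open>ln P\<close> is \<open>\<beta> X\<close> plus a
  separable term \<open>a\<^sub>i + b\<^sub>j\<close>, whose pairing with any doubly stochastic \<open>S\<close> is constant; hence the
  objective at \<open>S\<close> is a constant minus \<open>1 / \<beta>\<close> times the relative entropy of \<open>S\<close> with respect to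
  \<open>P\<close>, and Gibbs' inequality makes \<open>P\<close> the unique maximizer. Conversely a maximizer exists by
  compactness, is positive because mixing in the uniform matrix gains entropy at an infinite rate,
  and stationarity in the directions \<open>(e\<^sub>i - e\<^sub>k) (e\<^sub>j - e\<^sub>l)\<^sup>T\<close> makes it such a scaling. So softassign
  is the Sinkhorn scaling of \<open>exp (\<beta> X)\<close>, and a Hadamard power of a scaling of \<open>exp (\<beta> X)\<close> is
  again a scaling of an entrywise exponential.
\<close>

section \<open>Diagonal equivalence of matrices\<close>

text \<open>Repeats the existential in \<open>sinkhorn\<close> verbatim, so that it can be folded
  there and handled as an equivalence relation.\<close>

definition diag_equiv :: "real^'n^'n \<Rightarrow> real^'n^'n \<Rightarrow> bool" where
  "diag_equiv Y P \<longleftrightarrow> (\<exists>r c. positive_vec r \<and> positive_vec c \<and> P = diag_mat r ** Y ** diag_mat c)"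

definition exp_mat :: "real^'n^'n \<Rightarrow> real^'n^'n" where
  "exp_mat X = (\<chi> i j. exp (X $ i $ j))"

lemma diag_mat_mult_nth:
  "(diag_mat r ** Y ** diag_mat c) $ i $ j = r $ i * Y $ i $ j * c $ j"
  by (simp add: matrix_matrix_mult_def diag_mat_def if_distrib if_distribR
      cong: if_cong)

lemma diag_equiv_iff:
  "diag_equiv Y P \<longleftrightarrow>
     (\<exists>f g. (\<forall>i. f i > 0) \<and> (\<forall>j. g j > 0) \<and> (\<forall>i j. P $ i $ j = f i * Y $ i $ j * g j))"
proof
  assume "diag_equiv Y P"
  then obtain r c where "positive_vec r" "positive_vec c" "P = diag_mat r ** Y ** diag_mat c"
    unfolding diag_equiv_def by blast
  then show "\<exists>f g. (\<forall>i. f i > 0) \<and> (\<forall>j. g j > 0) \<and> (\<forall>i j. P $ i $ j = f i * Y $ i $ j * g j)"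
    by (intro exI[of _ "\<lambda>i. r $ i"] exI[of _ "\<lambda>j. c $ j"]) (simp add: diag_mat_mult_nth positive_vec_def)
next
  assume "\<exists>f g. (\<forall>i. f i > 0) \<and> (\<forall>j. g j > 0) \<and> (\<forall>i j. P $ i $ j = f i * Y $ i $ j * g j)"
  then obtain f g where "\<And>i. f i > 0" "\<And>j. g j > 0" "\<And>i j. P $ i $ j = f i * Y $ i $ j * g j"
    by blast
  then show "diag_equiv Y P"
    unfolding diag_equiv_def
    by (intro exI[of _ "\<chi> i. f i"] exI[of _ "\<chi> j. g j"])
      (simp add: vec_eq_iff diag_mat_mult_nth positive_vec_def)
qed

lemma diag_equiv_sym:
  assumes "diag_equiv Y P"
  shows "diag_equiv P Y"
proof -
  obtain f g where fg: "\<And>i. f i > 0" "\<And>j. g j > 0" "\<And>i j. P $ i $ j = f i * Y $ i $ j * g j"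
    using assms unfolding diag_equiv_iff by blast
  have "f i \<noteq> 0" "g i \<noteq> 0" for i
    using fg(1,2)[of i] by auto
  then show ?thesis
    unfolding diag_equiv_iff using fg
    by (intro exI[of _ "\<lambda>i. inverse (f i)"] exI[of _ "\<lambda>j. inverse (g j)"]) (simp add: field_simps)
qed

lemma diag_equiv_trans:
  assumes "diag_equiv Y P" and "diag_equiv P Q"
  shows "diag_equiv Y Q"
proof -
  obtain f g where fg: "\<And>i. f i > 0" "\<And>j. g j > 0" "\<And>i j. P $ i $ j = f i * Y $ i $ j * g j"
    using assms(1) unfolding diag_equiv_iff by blast
  obtain f' g' where fg': "\<And>i. f' i > 0" "\<And>j. g' j > 0" "\<And>i j. Q $ i $ j = f' i * P $ i $ j * g' j"
    using assms(2) unfolding diag_equiv_iff by blast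
  show ?thesis
    unfolding diag_equiv_iff using fg fg'
    by (intro exI[of _ "\<lambda>i. f i * f' i"] exI[of _ "\<lambda>j. g j * g' j"]) simp
qed

text \<open>Real powers distribute over products of positive factors and turn exp x into exp (p x),
  so the scaling factors are simply raised to the power p.\<close>

lemma diag_equiv_hadamard_power:
  assumes "diag_equiv (exp_mat X) P"
  shows "diag_equiv (exp_mat (p *\<^sub>R X)) (hadamard_power P p)"
proof -
  obtain f g where fg: "\<And>i. f i > 0" "\<And>j. g j > 0"
      "\<And>i j. P $ i $ j = f i * exp_mat X $ i $ j * g j"
    using assms unfolding diag_equiv_iff by blast
  have "f i \<noteq> 0" "g i \<noteq> 0" "0 \<le> f i" "0 \<le> g i" for i
    using fg(1,2)[of i] by auto
  then show ?thesis
    unfolding diag_equiv_iff using fg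
    by (intro exI[of _ "\<lambda>i. f i powr p"] exI[of _ "\<lambda>j. g j powr p"])
      (simp add: hadamard_power_def exp_mat_def powr_mult exp_powr_real mult.commute)
qed

section \<open>Gibbs' inequality and uniqueness of the maximizer\<close>

text \<open>For s > 0 this is s times ln y \<le> y - 1 at y = p / s, where equality forces y = 1;
  for s = 0 it reads 0 \<le> p, which is strict.\<close>

lemma gibbs_pointwise:
  fixes s p :: real
  assumes "s \<ge> 0" and "p > 0"
  shows "s * ln p - s * ln s \<le> p - s" and "s * ln p - s * ln s = p - s \<longleftrightarrow> s = p"
proof -
  have *: "s * ln p - s * ln s \<le> p - s \<and> (s * ln p - s * ln s = p - s \<longleftrightarrow> s = p)"
  proof (cases "s = 0")
    case False
    then have s: "s > 0" using assms by simp
    have eq: "s * ln p - s * ln s = s * ln (p / s)" "p - s = s * (p / s - 1)"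
      using s assms by (simp_all add: ln_div field_simps)
    have "ln (p / s) \<le> p / s - 1"
      using s assms by (intro ln_le_minus_one) simp
    moreover have "ln (p / s) = p / s - 1 \<longleftrightarrow> s = p"
      using ln_eq_minus_one[of "p / s"] s assms by (auto simp: field_simps)
    ultimately show ?thesis
      unfolding eq using s by simp
  qed (use assms in auto)
  then show "s * ln p - s * ln s \<le> p - s" and "s * ln p - s * ln s = p - s \<longleftrightarrow> s = p"
    by blast+
qed

text \<open>Equal totals cancel the linear terms, so the nonnegative pointwise gaps
  \<open>d i j\<close> have a sum \<le> 0 and must all vanish.\<close>

lemma gibbs_matrix:
  fixes S P :: "real^'n^'n"
  assumes "\<And>i j. S $ i $ j \<ge> 0" and "\<And>i j. P $ i $ j > 0"
    and total: "(\<Sum>i\<in>UNIV. \<Sum>j\<in>UNIV. S $ i $ j) = (\<Sum>i\<in>UNIV. \<Sum>j\<in>UNIV. P $ i $ j)"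
    and le: "(\<Sum>i\<in>UNIV. \<Sum>j\<in>UNIV. S $ i $ j * ln (S $ i $ j))
             \<le> (\<Sum>i\<in>UNIV. \<Sum>j\<in>UNIV. S $ i $ j * ln (P $ i $ j))"
  shows "S = P"
proof -
  define d where "d i j = (P $ i $ j - S $ i $ j) -
      (S $ i $ j * ln (P $ i $ j) - S $ i $ j * ln (S $ i $ j))" for i j
  have d: "d i j \<ge> 0" "d i j = 0 \<longleftrightarrow> S $ i $ j = P $ i $ j" for i j
    using gibbs_pointwise[OF assms(1,2), of i j i j] unfolding d_def by auto
  have "(\<Sum>i\<in>UNIV. \<Sum>j\<in>UNIV. d i j) \<le> 0"
    using total le by (simp add: d_def sum_subtractf)
  then have "(\<Sum>i\<in>UNIV. \<Sum>j\<in>UNIV. d i j) = 0"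
    by (intro antisym sum_nonneg) (auto intro: d)
  then have "d i j = 0" for i j
    by (simp add: sum_nonneg_eq_0_iff sum_nonneg d(1))
  then show ?thesis
    using d(2) by (simp add: vec_eq_iff)
qed

lemma inner_matrix: "S \<bullet> X = (\<Sum>i\<in>UNIV. \<Sum>j\<in>UNIV. S $ i $ j * X $ i $ j)"
  for S X :: "real^'n^'m"
  by (simp add: inner_vec_def)

text \<open>Each \<open>a i\<close> is weighted by a row sum and each \<open>b j\<close> by a column
  sum, all equal to 1.\<close>

lemma doubly_stochastic_sum_separable:
  assumes "S \<in> doubly_stochastic"
  shows "(\<Sum>i\<in>UNIV. \<Sum>j\<in>UNIV. S $ i $ j * (a i + b j)) = sum a UNIV + sum b UNIV"
proof -
  have rows: "(\<Sum>j\<in>UNIV. S $ i $ j) = 1" and cols: "(\<Sum>j\<in>UNIV. S $ j $ i) = 1" for i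
    using assms by (auto simp: doubly_stochastic_def)
  have "(\<Sum>i\<in>UNIV. \<Sum>j\<in>UNIV. S $ i $ j * a i) = sum a UNIV"
    by (simp flip: sum_distrib_right add: rows)
  moreover have "(\<Sum>i\<in>UNIV. \<Sum>j\<in>UNIV. S $ i $ j * b j) = sum b UNIV"
    by (subst sum.swap) (simp flip: sum_distrib_right add: cols)
  ultimately show ?thesis
    by (simp add: distrib_left sum.distrib)
qed

text \<open>Stated for any competitor that does at least as well as \<open>P\<close>, so that it
  yields both maximality and uniqueness of \<open>P\<close>.\<close>

lemma diag_equiv_exp_mat_maximal:
  fixes X P S :: "real^'n^'n"
  assumes \<beta>: "\<beta> > 0"
    and P: "P \<in> doubly_stochastic" "diag_equiv (exp_mat (\<beta> *\<^sub>R X)) P"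
    and S: "S \<in> doubly_stochastic"
    and ge: "softassign_objective \<beta> X P \<le> softassign_objective \<beta> X S"
  shows "S = P"
proof -
  obtain f g where fg: "\<And>i. f i > 0" "\<And>j. g j > 0"
      "\<And>i j. P $ i $ j = f i * exp_mat (\<beta> *\<^sub>R X) $ i $ j * g j"
    using P(2) unfolding diag_equiv_iff by blast
  have ln_P: "ln (P $ i $ j) = \<beta> * X $ i $ j + (ln (f i) + ln (g j))" for i j
    using fg(1)[of i] fg(2)[of j] unfolding fg(3) by (simp add: exp_mat_def ln_mult)
  define C where "C = (\<Sum>i\<in>UNIV. ln (f i)) + (\<Sum>j\<in>UNIV. ln (g j))"
  \<comment> \<open>Applied to \<open>P\<close>, where the left side is the negative entropy of
    \<open>P\<close>, and to \<open>S\<close>; the constant \<open>C\<close> then cancels.\<close>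
  have cross: "(\<Sum>i\<in>UNIV. \<Sum>j\<in>UNIV. T $ i $ j * ln (P $ i $ j)) = \<beta> * (T \<bullet> X) + C"
    if "T \<in> doubly_stochastic" for T
  proof -
    have "(\<Sum>i\<in>UNIV. \<Sum>j\<in>UNIV. T $ i $ j * ln (P $ i $ j)) =
        (\<Sum>i\<in>UNIV. \<Sum>j\<in>UNIV. \<beta> * (T $ i $ j * X $ i $ j)) +
        (\<Sum>i\<in>UNIV. \<Sum>j\<in>UNIV. T $ i $ j * (ln (f i) + ln (g j)))"
      unfolding ln_P by (simp add: distrib_left sum.distrib mult_ac)
    then show ?thesis
      unfolding doubly_stochastic_sum_separable[OF that] C_def inner_matrix
      by (simp add: sum_distrib_left)
  qed
  have obj: "\<beta> * softassign_objective \<beta> X T = \<beta> * (T \<bullet> X) + entropy_mat T" for T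
    using \<beta> by (simp add: softassign_objective_def distrib_left)
  have "\<beta> * softassign_objective \<beta> X P \<le> \<beta> * softassign_objective \<beta> X S"
    using ge \<beta> by simp
  then have "\<beta> * (P \<bullet> X) + entropy_mat P \<le> \<beta> * (S \<bullet> X) + entropy_mat S"
    unfolding obj .
  moreover have "entropy_mat P = - (\<beta> * (P \<bullet> X) + C)"
    unfolding entropy_mat_def cross[OF P(1)] ..
  ultimately have le: "(\<Sum>i\<in>UNIV. \<Sum>j\<in>UNIV. S $ i $ j * ln (S $ i $ j))
      \<le> (\<Sum>i\<in>UNIV. \<Sum>j\<in>UNIV. S $ i $ j * ln (P $ i $ j))"
    unfolding cross[OF S] by (simp add: entropy_mat_def)
  show ?thesis
  proof (rule gibbs_matrix[OF _ _ _ le])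
    show "S $ i $ j \<ge> 0" for i j
      using S by (simp add: doubly_stochastic_def)
    show "P $ i $ j > 0" for i j
      unfolding fg(3) by (simp add: fg(1,2) exp_mat_def)
    show "(\<Sum>i\<in>UNIV. \<Sum>j\<in>UNIV. S $ i $ j) = (\<Sum>i\<in>UNIV. \<Sum>j\<in>UNIV. P $ i $ j)"
      using S P(1) by (simp add: doubly_stochastic_def)
  qed
qed

section \<open>Existence of a maximizer by compactness\<close>

lemma compact_doubly_stochastic: "compact (doubly_stochastic :: (real^'n^'n) set)"
proof -
  have "closed (doubly_stochastic :: (real^'n^'n) set)"
    unfolding doubly_stochastic_def
    by (intro closed_Collect_conj closed_Collect_all closed_Collect_le closed_Collect_eq
        continuous_intros)
  moreover have "bounded (doubly_stochastic :: (real^'n^'n) set)"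
  proof (rule boundedI)
    fix S :: "real^'n^'n"
    assume S: "S \<in> doubly_stochastic"
    have "norm S \<le> (\<Sum>i\<in>UNIV. norm (S $ i))"
      unfolding norm_vec_def by (rule L2_set_le_sum) simp
    also have "\<dots> \<le> (\<Sum>i\<in>UNIV. \<Sum>j\<in>UNIV. \<bar>S $ i $ j\<bar>)"
      by (intro sum_mono norm_le_l1_cart)
    also have "\<dots> = real CARD('n)"
      using S by (simp add: doubly_stochastic_def)
    finally show "norm S \<le> real CARD('n)" .
  qed
  ultimately show ?thesis
    by (simp add: compact_eq_bounded_closed)
qed

lemma continuous_on_x_ln_x: "continuous_on {0..} (\<lambda>x::real. x * ln x)"
  unfolding continuous_on_def
proof
  fix x :: real
  assume "x \<in> {0..}"
  show "((\<lambda>x. x * ln x) \<longlongrightarrow> x * ln x) (at x within {0..})"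
  \<comment> \<open>The boundary point 0 is the only delicate one: the value there is 0, and x ln x
    tends to 0 from the right.\<close>
  proof (cases "x = 0")
    case True
    have "((\<lambda>x::real. x * ln x) \<longlongrightarrow> 0) (at_right 0)"
      by real_asymp
    then show ?thesis
      using True by (simp add: at_within_Ici_at_right)
  next
    case False
    then show ?thesis
      by (intro tendsto_intros)
  qed
qed

lemma continuous_on_softassign_objective:
  fixes X :: "real^'n^'n"
  shows "continuous_on doubly_stochastic (softassign_objective \<beta> X)"
proof -
  have entry: "continuous_on doubly_stochastic (\<lambda>S :: real^'n^'n. S $ i $ j * ln (S $ i $ j))" for i j
    by (rule continuous_on_compose2[OF continuous_on_x_ln_x, where f = "\<lambda>S. S $ i $ j"])
      (auto intro!: continuous_intros simp: doubly_stochastic_def)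
  show ?thesis
    unfolding softassign_objective_def entropy_mat_def by (intro entry continuous_intros)
qed

lemma uniform_doubly_stochastic: "(\<chi> i j. 1 / real CARD('n)) \<in> (doubly_stochastic :: (real^'n^'n) set)"
  by (simp add: doubly_stochastic_def)

lemma softassign_maximizer_exists:
  obtains S where "S \<in> doubly_stochastic"
    and "\<And>T. T \<in> doubly_stochastic \<Longrightarrow> softassign_objective \<beta> X T \<le> softassign_objective \<beta> X S"
  using continuous_attains_sup[OF compact_doubly_stochastic _ continuous_on_softassign_objective]
    uniform_doubly_stochastic by blast

section \<open>Positivity of a maximizer\<close>

text \<open>Gibbs' inequality against the mean z is applied at x and at y; in the weighted sum the
  right-hand sides cancel, since (1 - t)(z - x) + t(z - y) = 0. This argument covers the endpoint 0
  as well.\<close>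

lemma convex_on_x_ln_x: "convex_on {0..} (\<lambda>x::real. x * ln x)"
proof (rule convex_onI)
  fix t x y :: real
  assume t: "0 < t" "t < 1" and xy: "x \<in> {0..}" "y \<in> {0..}"
  define z where "z = (1 - t) * x + t * y"
  have z: "z \<ge> 0"
    using t xy by (simp add: z_def)
  have "z * ln z \<le> (1 - t) * (x * ln x) + t * (y * ln y)"
  proof (cases "z = 0")
    case True
    then have "(1 - t) * x = 0 \<and> t * y = 0"
      unfolding z_def using t xy by (subst (asm) add_nonneg_eq_0_iff) auto
    then show ?thesis
      using True t by auto
  next
    case False
    then have "z > 0" using z by simp
    then have "(1 - t) * (x * ln z - x * ln x) \<le> (1 - t) * (z - x)"
        "t * (y * ln z - y * ln y) \<le> t * (z - y)"
      using t xy by (auto intro!: mult_left_mono gibbs_pointwise(1))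
    then show ?thesis
      by (simp add: z_def algebra_simps)
  qed
  then show "((1 - t) *\<^sub>R x + t *\<^sub>R y) * ln ((1 - t) *\<^sub>R x + t *\<^sub>R y)
      \<le> (1 - t) * (x * ln x) + t * (y * ln y)"
    by (simp add: z_def)
qed (rule convex_real_interval)

lemma softassign_maximizer_positive:
  fixes X S :: "real^'n^'n"
  assumes \<beta>: "\<beta> > 0" and S: "S \<in> doubly_stochastic"
    and max: "\<And>T. T \<in> doubly_stochastic \<Longrightarrow> softassign_objective \<beta> X T \<le> softassign_objective \<beta> X S"
  shows "S $ a $ b > 0"
proof (rule ccontr)
  assume "\<not> S $ a $ b > 0"
  moreover have S_nonneg: "S $ i $ j \<ge> 0" for i j
    using S by (simp add: doubly_stochastic_def)
  ultimately have S0: "S $ a $ b = 0"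
    by (meson antisym not_less)
  define u where "u = 1 / real CARD('n)"
  have u: "u > 0"
    by (simp add: u_def)
  define U :: "real^'n^'n" where "U = (\<chi> i j. u)"
  have U: "U \<in> doubly_stochastic"
    unfolding U_def u_def by (rule uniform_doubly_stochastic)
  let ?F = "softassign_objective \<beta> X"
  \<comment> \<open>Chosen so that the entropy gain - t u ln t / \<beta> at the zero entry exceeds
    the possible loss t (F S - F U) by at least t; the bound 1/2 keeps t below 1.\<close>
  define t where "t = min (1/2) (exp (- (?F S - ?F U + 1) * \<beta> / u))"
  have t: "0 < t" "t < 1"
    by (simp_all add: t_def min_less_iff_disj)
  have "ln t \<le> ln (exp (- (?F S - ?F U + 1) * \<beta> / u))"
    using t(1) by (subst ln_le_cancel_iff) (simp_all only: t_def min.cobounded2 exp_gt_zero)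
  then have ln_t: "u * ln t \<le> - (?F S - ?F U + 1) * \<beta>"
    using u by (simp add: field_simps)
  define T where "T = (1 - t) *\<^sub>R S + t *\<^sub>R U"
  have T_nth: "T $ i $ j = (1 - t) * S $ i $ j + t * u" for i j
    by (simp add: T_def U_def)
  have T: "T \<in> doubly_stochastic"
    using S U t unfolding doubly_stochastic_def T_def
    by (simp add: sum.distrib flip: sum_distrib_left)
  \<comment> \<open>The correction to the convexity bound: at the zero entry \<open>T\<close> equals
    t u, and t u ln (t u) = t u ln u + t u ln t exactly. Elsewhere plain convexity suffices.\<close>
  define e where "e i j = (if i = a \<and> j = b then t * (u * ln t) else 0)" for i j
  have entry: "T $ i $ j * ln (T $ i $ j) \<le>
      ((1 - t) * (S $ i $ j * ln (S $ i $ j)) + t * (U $ i $ j * ln (U $ i $ j))) + e i j" for i j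
  proof (cases "i = a \<and> j = b")
    case True
    then show ?thesis
      using S0 t u by (simp add: T_nth U_def e_def ln_mult algebra_simps)
  next
    case False
    then show ?thesis
      using convex_onD[OF convex_on_x_ln_x, of t "S $ i $ j" u] t u S_nonneg
      by (auto simp add: T_nth U_def e_def)
  qed
  have "(\<Sum>i\<in>UNIV. \<Sum>j\<in>UNIV. T $ i $ j * ln (T $ i $ j)) \<le>
     (\<Sum>i\<in>UNIV. \<Sum>j\<in>UNIV.
       ((1 - t) * (S $ i $ j * ln (S $ i $ j)) + t * (U $ i $ j * ln (U $ i $ j))) + e i j)"
    by (intro sum_mono entry)
  also have "\<dots> = (1 - t) * (- entropy_mat S) + t * (- entropy_mat U) + (\<Sum>i\<in>UNIV. \<Sum>j\<in>UNIV. e i j)"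
    by (simp only: sum.distrib entropy_mat_def minus_minus flip: sum_distrib_left)
  also have "(\<Sum>i\<in>UNIV. \<Sum>j\<in>UNIV. e i j) = (\<Sum>i\<in>UNIV. if i = a then t * (u * ln t) else 0)"
    by (intro sum.cong refl) (simp add: e_def)
  also have "\<dots> = t * (u * ln t)"
    by simp
  finally have ent: "entropy_mat T \<ge> (1 - t) * entropy_mat S + t * entropy_mat U - t * (u * ln t)"
    by (simp add: entropy_mat_def)
  have inner_T: "T \<bullet> X = (1 - t) * (S \<bullet> X) + t * (U \<bullet> X)"
    by (simp add: T_def inner_add_left)
  have "?F T \<ge> T \<bullet> X + (1 / \<beta>) * ((1 - t) * entropy_mat S + t * entropy_mat U - t * (u * ln t))"
    unfolding softassign_objective_def using \<beta> ent by (intro add_left_mono mult_left_mono) auto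
  moreover have "T \<bullet> X + (1 / \<beta>) * ((1 - t) * entropy_mat S + t * entropy_mat U - t * (u * ln t)) =
      (1 - t) * ?F S + t * ?F U - t * (u * ln t / \<beta>)"
    using \<beta> by (simp add: softassign_objective_def inner_T field_simps)
  moreover have "t * (u * ln t / \<beta>) \<le> t * (- (?F S - ?F U + 1))"
    using ln_t \<beta> t by (intro mult_left_mono) (simp_all add: field_simps)
  ultimately have "?F T \<ge> ?F S + t"
    by (simp add: algebra_simps)
  then show False
    using max[OF T] t by simp
qed

section \<open>First-order conditions and the scaling form\<close>

text \<open>Zero row and column sums preserve the linear constraints, and positivity of
  \<open>S\<close> allows small steps along \<open>E\<close> in both directions, so the objective on
  this line has an interior maximum at 0.\<close>

lemma softassign_maximizer_stationary:
  fixes X S E :: "real^'n^'n"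
  assumes \<beta>: "\<beta> > 0" and S: "S \<in> doubly_stochastic"
    and max: "\<And>T. T \<in> doubly_stochastic \<Longrightarrow> softassign_objective \<beta> X T \<le> softassign_objective \<beta> X S"
    and rows: "\<And>i. (\<Sum>j\<in>UNIV. E $ i $ j) = 0" and cols: "\<And>j. (\<Sum>i\<in>UNIV. E $ i $ j) = 0"
  shows "(\<Sum>i\<in>UNIV. \<Sum>j\<in>UNIV. E $ i $ j * (\<beta> * X $ i $ j - ln (S $ i $ j))) = 0"
proof -
  have pos: "S $ i $ j > 0" for i j
    using softassign_maximizer_positive[OF \<beta> S max] .
  define h where "h t = softassign_objective \<beta> X (S + t *\<^sub>R E)" for t
  \<comment> \<open>The term \<open>E $ i $ j\<close> without a logarithm comes from differentiating
    x ln x; it sums to zero at the end because the rows of \<open>E\<close> do.\<close>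
  define D where "D = (\<Sum>i\<in>UNIV. \<Sum>j\<in>UNIV.
      E $ i $ j * X $ i $ j - (1 / \<beta>) * (E $ i $ j * ln (S $ i $ j) + E $ i $ j))"
  have h: "h t = (\<Sum>i\<in>UNIV. \<Sum>j\<in>UNIV. (S $ i $ j + t * E $ i $ j) * X $ i $ j -
      (1 / \<beta>) * ((S $ i $ j + t * E $ i $ j) * ln (S $ i $ j + t * E $ i $ j)))" for t
    by (simp add: h_def softassign_objective_def inner_matrix entropy_mat_def sum_subtractf
        sum_distrib_left sum_negf)
  have "((\<lambda>t. (S $ i $ j + t * E $ i $ j) * X $ i $ j -
      (1 / \<beta>) * ((S $ i $ j + t * E $ i $ j) * ln (S $ i $ j + t * E $ i $ j)))
      has_real_derivative
      E $ i $ j * X $ i $ j - (1 / \<beta>) * (E $ i $ j * ln (S $ i $ j) + E $ i $ j)) (at 0)" for i j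
    using pos[of i j] \<beta> by (auto intro!: derivative_eq_intros simp: field_simps)
  then have deriv: "(h has_real_derivative D) (at 0)"
    unfolding h[abs_def] D_def by (intro DERIV_sum)
  have "\<forall>\<^sub>F t in nhds 0. \<forall>i j. S $ i $ j + t * E $ i $ j > 0"
  proof (intro eventually_all_finite)
    fix i j
    have "((\<lambda>t. S $ i $ j + t * E $ i $ j) \<longlongrightarrow> S $ i $ j + 0 * E $ i $ j) (nhds 0)"
      by (intro tendsto_intros filterlim_ident)
    then show "\<forall>\<^sub>F t in nhds 0. S $ i $ j + t * E $ i $ j > 0"
      by (rule order_tendstoD) (simp add: pos)
  qed
  then obtain d where d: "d > 0" "\<And>t i j. \<bar>t\<bar> < d \<Longrightarrow> S $ i $ j + t * E $ i $ j > 0"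
    unfolding eventually_nhds_metric by (auto simp: dist_real_def)
  have "D = 0"
  proof (rule DERIV_local_max[OF deriv d(1)], intro allI impI)
    fix t :: real
    assume "\<bar>0 - t\<bar> < d"
    then have "\<And>i j. 0 \<le> S $ i $ j + t * E $ i $ j"
      using d(2)[of t] by (simp add: less_imp_le)
    then have "S + t *\<^sub>R E \<in> doubly_stochastic"
      using S by (simp add: doubly_stochastic_def sum.distrib rows cols flip: sum_distrib_left)
    then show "h t \<le> h 0"
      using max by (simp add: h_def)
  qed
  then have "\<beta> * D = 0"
    by simp
  moreover have "\<beta> * D = (\<Sum>i\<in>UNIV. \<Sum>j\<in>UNIV.
      E $ i $ j * (\<beta> * X $ i $ j - ln (S $ i $ j)) - E $ i $ j)"
    unfolding D_def sum_distrib_left using \<beta> by (intro sum.cong refl) (simp add: field_simps)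
  ultimately show ?thesis
    by (simp add: sum_subtractf rows)
qed

lemma sum_of_bool_diff_mult:
  fixes m :: "'n::finite \<Rightarrow> real"
  shows "(\<Sum>a\<in>UNIV. (of_bool (a = i) - of_bool (a = k)) * m a) = m i - m k"
proof -
  have "(\<Sum>a\<in>UNIV. of_bool (a = l) * m a) = m l" for l
    by (subst sum.cong[OF refl, of _ _ "\<lambda>a. if a = l then m a else 0"]) auto
  then show ?thesis
    by (simp only: left_diff_distrib sum_subtractf)
qed

text \<open>Stationarity along rank-one exchanges gives a four-point identity for \<open>M\<close>,
  which splits \<open>M\<close> into a row term plus a column term; exponentiating \<beta> X - M
  then gives the scaling.\<close>

lemma softassign_maximizer_diag_equiv:
  fixes X S :: "real^'n^'n"
  assumes \<beta>: "\<beta> > 0" and S: "S \<in> doubly_stochastic"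
    and max: "\<And>T. T \<in> doubly_stochastic \<Longrightarrow> softassign_objective \<beta> X T \<le> softassign_objective \<beta> X S"
  shows "diag_equiv (exp_mat (\<beta> *\<^sub>R X)) S"
proof -
  have pos: "S $ i $ j > 0" for i j
    using softassign_maximizer_positive[OF \<beta> S max] .
  define M where "M i j = \<beta> * X $ i $ j - ln (S $ i $ j)" for i j
  have exchange: "M i j + M k l = M i l + M k j" for i j k l
  proof -
    define E :: "real^'n^'n"
      where "E = (\<chi> a b. (of_bool (a = i) - of_bool (a = k)) * (of_bool (b = j) - of_bool (b = l)))"
    have "(\<Sum>a\<in>UNIV. \<Sum>b\<in>UNIV. E $ a $ b * (\<beta> * X $ a $ b - ln (S $ a $ b))) = 0"
      by (rule softassign_maximizer_stationary[OF \<beta> S max])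
        (simp_all add: E_def sum_subtractf of_bool_def flip: sum_distrib_left sum_distrib_right)
    moreover have "(\<Sum>b\<in>UNIV. E $ a $ b * M a b) =
        (of_bool (a = i) - of_bool (a = k)) * (M a j - M a l)" for a
    proof -
      have "(\<Sum>b\<in>UNIV. E $ a $ b * M a b) = (of_bool (a = i) - of_bool (a = k)) *
          (\<Sum>b\<in>UNIV. (of_bool (b = j) - of_bool (b = l)) * M a b)"
        by (simp add: E_def sum_distrib_left mult.assoc)
      also have "(\<Sum>b\<in>UNIV. (of_bool (b = j) - of_bool (b = l)) * M a b) = M a j - M a l"
        by (rule sum_of_bool_diff_mult)
      finally show ?thesis .
    qed
    moreover have "(\<Sum>a\<in>UNIV. (of_bool (a = i) - of_bool (a = k)) * (M a j - M a l)) =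
        (M i j - M i l) - (M k j - M k l)"
      by (rule sum_of_bool_diff_mult)
    ultimately show ?thesis
      by (simp add: M_def)
  qed
  \<comment> \<open>An arbitrary base index: the exchange identity with both \<open>k\<close> and
    \<open>l\<close> equal to it gives M i j = M i k + M k j - M k k.\<close>
  obtain k :: 'n where True by simp
  have S_eq: "S $ i $ j = exp (M k k - M i k) * exp (\<beta> * X $ i $ j) * exp (- M k j)" for i j
  proof -
    have "ln (S $ i $ j) = (M k k - M i k) + \<beta> * X $ i $ j + - M k j"
      using exchange[of i j k k] by (simp add: M_def)
    then have "exp (ln (S $ i $ j)) = exp ((M k k - M i k) + \<beta> * X $ i $ j + - M k j)"
      by simp
    then show ?thesis
      unfolding exp_add using pos by simp
  qed
  then show ?thesis
    unfolding diag_equiv_iff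
    by (intro exI[of _ "\<lambda>i. exp (M k k - M i k)"] exI[of _ "\<lambda>j. exp (- M k j)"])
      (simp add: exp_mat_def)
qed

section \<open>Softassign as a Sinkhorn scaling\<close>

lemma softassign_eqI:
  assumes "\<beta> > 0" and "P \<in> doubly_stochastic" and "diag_equiv (exp_mat (\<beta> *\<^sub>R X)) P"
  shows "softassign \<beta> X = P"
  unfolding softassign_def
proof (rule the_equality)
  show "is_arg_max (softassign_objective \<beta> X) (\<lambda>S. S \<in> doubly_stochastic) P"
    unfolding is_arg_max_def using assms diag_equiv_exp_mat_maximal less_imp_le by blast
next
  fix S
  assume "is_arg_max (softassign_objective \<beta> X) (\<lambda>S. S \<in> doubly_stochastic) S"
  then show "S = P"
    unfolding is_arg_max_def using assms diag_equiv_exp_mat_maximal not_less by blast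
qed

text \<open>The maximizer found by compactness is a scaling, and \<open>softassign_eqI\<close>
  identifies it with \<open>softassign\<close>. This also supplies the existence half of Sinkhorn's
  theorem for the matrices \<open>exp_mat\<close>.\<close>

lemma softassign_scaling:
  assumes "\<beta> > 0"
  shows "softassign \<beta> X \<in> doubly_stochastic"
    and "diag_equiv (exp_mat (\<beta> *\<^sub>R X)) (softassign \<beta> X)"
proof -
  obtain S where "S \<in> doubly_stochastic"
    and "\<And>T. T \<in> doubly_stochastic \<Longrightarrow> softassign_objective \<beta> X T \<le> softassign_objective \<beta> X S"
    using softassign_maximizer_exists by blast
  with assms softassign_eqI softassign_maximizer_diag_equiv
  show "softassign \<beta> X \<in> doubly_stochastic" "diag_equiv (exp_mat (\<beta> *\<^sub>R X)) (softassign \<beta> X)"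
    by metis+
qed

text \<open>By symmetry and transitivity, the scalings of \<open>Y\<close> are those of
  \<open>exp_mat\<close>, and the doubly stochastic one among them is unique.\<close>

lemma sinkhorn_eq_softassign:
  assumes "\<beta> > 0" and "diag_equiv (exp_mat (\<beta> *\<^sub>R X)) Y"
  shows "sinkhorn Y = softassign \<beta> X"
  unfolding sinkhorn_def diag_equiv_def[symmetric]
proof (rule the_equality)
  show "softassign \<beta> X \<in> doubly_stochastic \<and> diag_equiv Y (softassign \<beta> X)"
    using softassign_scaling[OF assms(1)] assms(2) diag_equiv_sym diag_equiv_trans by blast
next
  fix P
  assume "P \<in> doubly_stochastic \<and> diag_equiv Y P"
  then show "P = softassign \<beta> X"
    using softassign_eqI[OF assms(1)] assms(2) diag_equiv_trans by metis
qed

theorem mainTheorem1: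
  fixes X :: "real^'n^'n" and \<beta>\<^sub>1 \<beta>\<^sub>2 :: real
  assumes "positive_mat X" and "\<beta>\<^sub>1 > 0" and "\<beta>\<^sub>2 > 0"
  shows "softassign \<beta>\<^sub>2 X = sinkhorn (hadamard_power (softassign \<beta>\<^sub>1 X) (\<beta>\<^sub>2 / \<beta>\<^sub>1))"
proof -
  \<comment> \<open>The quotient times \<open>\<beta>\<^sub>1\<close> is
    \<open>\<beta>\<^sub>2\<close>, so the power is a scaling of the matrix that defines the second
    softassign.\<close>
  have "diag_equiv (exp_mat ((\<beta>\<^sub>2 / \<beta>\<^sub>1) *\<^sub>R \<beta>\<^sub>1 *\<^sub>R X)) (hadamard_power (softassign \<beta>\<^sub>1 X) (\<beta>\<^sub>2 / \<beta>\<^sub>1))"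
    using assms by (intro diag_equiv_hadamard_power softassign_scaling)
  then show ?thesis
    using assms sinkhorn_eq_softassign[of \<beta>\<^sub>2 X] by simp
qed

end
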